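(* Let $(x_k)_{k\ge 1}$ be a sequence of real numbers in $[0,1]$ which is uniformly distributed modulo one. Then for all sufficiently large $N$ we have $$\prod_{k=1}^N 2\sin(\pi x_k)\le \left(\frac{N}{\Delta_N}\right)^{2\Delta_N},$$ where $\Delta_N := N D_N^*$ and $D_N^*=D_N^*(x_1,\dots,x_N)$ is the star-discrepancy of $x_1,\dots,x_N$.
   Context: For $x_1,\dots,x_N\in[0,1]$ the star-discrepancy is $D_N^*(x_1,\dots,x_N)=\sup_{a\in[0,1]}\left|\frac{A_N(a)}{N}-a\right|$, where $A_N(a)=\#\{1\le n\le N: x_n\in[0,a)\}$. An infinite sequence $(x_k)_{k\ge1}$ in $[0,1]$ is uniformly distributed modulo one if $\lim_{N\to\infty}A_N(a)/N=a$ for all $a\in[0,1]$; equivalently, $\lim_{N\to\infty}D_N^*(x_1,\dots,x_N)=0$. *)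

theory Defs
  imports Complex_Main
begin

text \<open>Sequences are indexed from 1; the value at index 0 of a function on \<^typ>\<open>nat\<close> plays no role.\<close>

definition counting :: "(nat \<Rightarrow> real) \<Rightarrow> nat \<Rightarrow> real \<Rightarrow> nat" where
  "counting x N a = card {n \<in> {1..N}. x n \<in> {0..<a}}"

definition star_discrepancy :: "(nat \<Rightarrow> real) \<Rightarrow> nat \<Rightarrow> real" where
  "star_discrepancy x N = (SUP a\<in>{0..1}. \<bar>real (counting x N a) / real N - a\<bar>)"

text \<open>Stated without fractional parts, so only meant for sequences with values in $[0,1]$.\<close>

definition uniformly_distributed_mod_one :: "(nat \<Rightarrow> real) \<Rightarrow> bool" where
  "uniformly_distributed_mod_one x \<longleftrightarrow>
     (\<forall>a\<in>{0..1}. (\<lambda>N. real (counting x N a) / real N) \<longlonglongrightarrow> a)"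

end

theory Submission
  imports Defs "HOL-Analysis.Analysis" "HOL-Real_Asymp.Real_Asymp"
begin

text \<open>
  Write $f(t) = \ln(2 \sin \pi t)$ and $D$ for the star-discrepancy. After sorting, the $i$-th point
  (counting from $0$) lies within $D$ of every point of $[i/N, (i+1)/N]$. Hence the sum of the values
  of $f$ at the points is at most $N$ times the integral over $[0,1]$ of the maximum of $f$ over
  $[u-D, u+D]$. Since $f$ has integral $0$ over $[0,1/2]$, this integral equals
  $2 D \ln 2 - 2 \int_0^D f$, and $\int_0^D f = D \ln(2 \pi D) - D + o(D)$ as $D \to 0$. The
  resulting bound is $N (-2 D \ln D - 2 D (\ln \pi - 1) + o(D))$, and $\ln \pi > 1$ absorbs the
  error term.
\<close>

section \<open>The integral of ln(2 sin(pi t)) and its behaviour at 0\<close>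

definition log_two_sin :: "real \<Rightarrow> real" where
  "log_two_sin t = ln (2 * sin (pi * t))"

text \<open>The regular part of \<open>log_two_sin\<close>: for 0 < t < 1,
  \<open>log_two_sin t\<close> is ln(2 pi t) plus this function. The value at 0 is the limit
  there.\<close>

definition log_sinc :: "real \<Rightarrow> real" where
  "log_sinc t = (if t = 0 then 0 else ln (sin (pi * t) / (pi * t)))"

lemma sin_pi_pos: "0 < t \<Longrightarrow> t < 1 \<Longrightarrow> 0 < sin (pi * t)"
  by (intro sin_gt_zero) auto

lemma isCont_log_sinc_0: "isCont log_sinc 0"
proof -
  have "((\<lambda>t::real. ln (sin (pi * t) / (pi * t))) \<longlongrightarrow> 0) (at 0)"
    by real_asymp
  then have "(log_sinc \<longlongrightarrow> 0) (at 0)"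
    by (rule Lim_transform_eventually) (auto simp: log_sinc_def eventually_at_filter)
  then show ?thesis
    by (simp add: isCont_def log_sinc_def)
qed

lemma isCont_log_sinc:
  assumes "0 \<le> t" "t < 1"
  shows "isCont log_sinc t"
proof (cases "t = 0")
  case False
  then have t: "0 < t" using assms by simp
  have "isCont (\<lambda>t. ln (sin (pi * t) / (pi * t))) t"
    using t sin_pi_pos[OF t assms(2)] by (intro continuous_intros) auto
  moreover have "\<forall>\<^sub>F s in nhds t. log_sinc s = ln (sin (pi * s) / (pi * s))"
    using t eventually_nhds_in_open[of "{0<..}" t]
    by (auto simp: log_sinc_def elim!: eventually_mono)
  ultimately show ?thesis
    using isCont_cong[of log_sinc] by auto
qed (simp add: isCont_log_sinc_0)

text \<open>The integral of $\ln(2 \sin \pi s)$ over $[0,t]$ (up to the normalisation of the Clausen function),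
  with the logarithmic singularity at $0$ integrated explicitly.\<close>
definition clausen :: "real \<Rightarrow> real" where
  "clausen t = t * ln (2 * pi * t) - t + integral {0..t} log_sinc"

lemma clausen_0: "clausen 0 = 0"
  by (simp add: clausen_def)

text \<open>Any bound strictly between 1/2 and 1 would serve as well as 3/4: the singularity at 1 is
  avoided, and 1/2 becomes an interior point, so that \<open>clausen\<close> has a two-sided
  derivative there.\<close>

lemma continuous_on_log_sinc: "continuous_on {0..3/4} log_sinc"
  by (auto intro!: continuous_at_imp_continuous_on isCont_log_sinc)

lemma clausen_has_derivative:
  assumes "0 < t" "t < 3/4"
  shows "(clausen has_real_derivative log_two_sin t) (at t)"
proof -
  have "((\<lambda>t. integral {0..t} log_sinc) has_real_derivative log_sinc t) (at t within {0..3/4})"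
    using assms by (intro integral_has_real_derivative continuous_on_log_sinc) auto
  then have D: "((\<lambda>t. integral {0..t} log_sinc) has_real_derivative log_sinc t) (at t)"
    using assms by (simp add: at_within_Icc_at)
  have "log_two_sin t = ln (2 * pi * t) + ln (sin (pi * t) / (pi * t))"
    using assms sin_pi_pos[of t] ln_mult[of "2 * pi * t" "sin (pi * t) / (pi * t)"]
    by (simp add: log_two_sin_def)
  then have "log_two_sin t = (ln (2 * pi * t) + t * (2 * pi / (2 * pi * t))) - 1 + log_sinc t"
    using assms by (simp add: log_sinc_def)
  moreover have "((\<lambda>t. t * ln (2 * pi * t) - t) has_real_derivative
      (ln (2 * pi * t) + t * (2 * pi / (2 * pi * t))) - 1) (at t)"
    using assms by (auto intro!: derivative_eq_intros)
  from DERIV_add[OF this D] show ?thesis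
    unfolding clausen_def[abs_def] using calculation by simp
qed

text \<open>Only 0 is delicate: there \<open>t * ln (2 * pi * t)\<close> is 0 through its factor
  \<open>t\<close>, and this is also its limit. Continuity up to 0 lets \<open>clausen_half\<close>
  evaluate its constant function at 0, outside the range of the derivative.\<close>

lemma continuous_on_clausen: "continuous_on {0..1/2} clausen"
proof -
  have "((\<lambda>t::real. t * ln (2 * pi * t)) \<longlongrightarrow> 0) (at_right 0)"
    by real_asymp
  then have "continuous (at_right 0) (\<lambda>t::real. t * ln (2 * pi * t))"
    by (simp add: continuous_within)
  then have "continuous (at t within {0..1/2}) (\<lambda>t::real. t * ln (2 * pi * t))"
    if "t \<in> {0..1/2}" for t
  proof (cases "t = 0")
    case True
    then show ?thesis
      using \<open>continuous (at_right 0) _\<close> by (simp add: at_within_Icc_at_right)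
  next
    case False
    then have "isCont (\<lambda>t::real. t * ln (2 * pi * t)) t"
      using that by (intro continuous_intros) auto
    then show ?thesis
      by (rule continuous_at_imp_continuous_at_within)
  qed
  then have "continuous_on {0..1/2} (\<lambda>t::real. t * ln (2 * pi * t))"
    by (simp add: continuous_on_eq_continuous_within)
  moreover have "log_sinc integrable_on {0..1/2}"
    by (rule integrable_continuous_real, rule continuous_on_subset[OF continuous_on_log_sinc]) auto
  ultimately show ?thesis
    unfolding clausen_def
    by (intro continuous_on_add continuous_on_diff continuous_on_id indefinite_integral_continuous_1)
qed

lemma clausen_half: "clausen (1/2) = 0"
proof -
  \<comment> \<open>The duplication formula $\sin 2z = 2 \sin z \sin(\pi/2 - z)$ makes \<open>H\<close> constant; compare its values
    at $0$ and $1/4$.\<close>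
  define H where "H s = clausen (2 * s) / 2 - clausen s + clausen (1/2 - s)" for s
  have "continuous_on {0..1/4} H"
    unfolding H_def
    by (intro continuous_intros continuous_on_compose2[OF continuous_on_clausen]) auto
  moreover have "(H has_real_derivative 0) (at s)" if "0 < s" "s < 1/4" for s
  proof -
    have "sin (pi * (2 * s)) = 2 * sin (pi * s) * sin (pi * (1/2 - s))"
      using sin_double[of "pi * s"] by (simp add: sin_diff algebra_simps)
    moreover have "sin (pi * s) > 0" "sin (pi * (1/2 - s)) > 0"
      using that by (auto intro!: sin_pi_pos)
    ultimately have "log_two_sin (2 * s) = log_two_sin s + log_two_sin (1/2 - s)"
      using ln_mult[of "2 * sin (pi * s)" "2 * sin (pi * (1/2 - s))"]
      by (simp add: log_two_sin_def mult_ac)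
    then have *: "log_two_sin (2 * s) * 2 / 2 - log_two_sin s + log_two_sin (1/2 - s) * (0 - 1) = 0"
      by (simp add: field_simps)
    have "((\<lambda>s. clausen (2 * s)) has_real_derivative log_two_sin (2 * s) * 2) (at s)"
      using that by (intro DERIV_chain2[OF clausen_has_derivative]) (auto intro!: derivative_eq_intros)
    moreover have "(clausen has_real_derivative log_two_sin s) (at s)"
      using that by (intro clausen_has_derivative) auto
    moreover have "((\<lambda>s. clausen (1/2 - s)) has_real_derivative log_two_sin (1/2 - s) * (0 - 1)) (at s)"
      using that by (intro DERIV_chain2[OF clausen_has_derivative]) (auto intro!: derivative_eq_intros)
    ultimately have "(H has_real_derivative
        log_two_sin (2 * s) * 2 / 2 - log_two_sin s + log_two_sin (1/2 - s) * (0 - 1)) (at s)"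
      unfolding H_def[abs_def] by (intro DERIV_add DERIV_diff DERIV_cdivide)
    then show ?thesis
      unfolding * .
  qed
  ultimately have "H (1/4) = H 0"
    by (intro DERIV_isconst_end) auto
  \<comment> \<open>At 1/4 the last two terms cancel and leave \<open>clausen (1/2) / 2\<close>; at
    0 only \<open>clausen (1/2)\<close> remains.\<close>
  then show ?thesis
    by (simp add: H_def clausen_0)
qed

text \<open>As \<open>log_sinc\<close> is continuous with value 0 at 0, it exceeds
  \<open>- \<epsilon>\<close> near 0, which bounds its integral. A lower bound is the right
  direction because \<open>clausen\<close> enters the final upper bound with a negative
  sign.\<close>

lemma clausen_lower:
  assumes "0 < \<epsilon>"
  shows "\<forall>\<^sub>F t in at_right 0. clausen t \<ge> t * ln (2 * pi * t) - t - \<epsilon> * t"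
proof -
  have "\<forall>\<^sub>F s in nhds 0. - \<epsilon> < log_sinc s"
    using isCont_log_sinc_0 assms
    by (intro order_tendstoD(1)[of _ "log_sinc 0"])
      (auto simp: isCont_def tendsto_at_iff_tendsto_nhds, simp add: log_sinc_def)
  then obtain d where d: "0 < d" "\<And>s. \<bar>s\<bar> < d \<Longrightarrow> - \<epsilon> < log_sinc s"
    by (auto simp: eventually_nhds_metric dist_real_def)
  have "clausen t \<ge> t * ln (2 * pi * t) - t - \<epsilon> * t" if t: "0 < t" "t < min d (1/2)" for t
  proof -
    have "log_sinc integrable_on {0..t}"
      using t by (intro integrable_continuous_real continuous_on_subset[OF continuous_on_log_sinc]) auto
    then have "integral {0..t} (\<lambda>_. - \<epsilon>) \<le> integral {0..t} log_sinc"
      using t by (intro integral_le) (auto intro!: less_imp_le[OF d(2)])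
    then show ?thesis
      using t by (simp add: clausen_def mult.commute)
  qed
  then show ?thesis
    using d(1) by (auto simp: eventually_at_right intro!: exI[of _ "min d (1/2)"])
qed

section \<open>The maximum over a moving window, its integral, and comparison with a sum\<close>

lemma continuous_on_log_two_sin_min:
  assumes "0 < d"
  shows "continuous_on {d..} (\<lambda>t. log_two_sin (min (1/2) t))"
proof -
  \<comment> \<open>Clamping keeps the argument in (0, 1/2], so the singularity at 1 is never met,
    even for \<open>t\<close> beyond 1.\<close>
  have "sin (pi * min (1/2) t) > 0" if "d \<le> t" for t
    using assms that by (intro sin_pi_pos) auto
  then show ?thesis
    unfolding log_two_sin_def by (intro continuous_intros) (force)+
qed

lemma log_two_sin_mono:
  assumes "0 < s" "s \<le> t" "t \<le> 1/2"
  shows "log_two_sin s \<le> log_two_sin t"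
proof -
  have "pi * s \<le> pi * t" "pi * t \<le> pi * (1/2)"
    using assms by (auto intro!: mult_left_mono)
  moreover have "- (pi / 2) \<le> pi * s" by (rule order_trans[of _ 0]) (use assms in auto)
  ultimately have "sin (pi * s) \<le> sin (pi * t)"
    by (intro sin_monotone_2pi_le) auto
  then show ?thesis
    using assms sin_pi_pos[of s] by (simp add: log_two_sin_def)
qed

lemma log_two_sin_half: "log_two_sin (1/2) = ln 2"
  by (simp add: log_two_sin_def)

lemma log_two_sin_reflect: "log_two_sin (1 - t) = log_two_sin t"
  by (simp add: log_two_sin_def algebra_simps sin_diff)

text \<open>The maximum of $\ln(2 \sin \pi t)$ on $[u-d, u+d]$ for $d < 1/2$: as at most one of the two arguments
  is below $1/2$, the other summand cancels $\ln 2$.\<close>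
definition log_two_sin_max :: "real \<Rightarrow> real \<Rightarrow> real" where
  "log_two_sin_max d u =
     log_two_sin (min (1/2) (u + d)) + log_two_sin (min (1/2) (1 - u + d)) - ln 2"

text \<open>\<open>log_two_sin\<close> increases up to 1/2 and is symmetric about it. A window left
  of 1/2 is governed by its right end \<open>u + d\<close>, one right of 1/2 by its left end, which
  reflection turns into \<open>1 - u + d\<close>. Otherwise the global maximum ln 2
  suffices.\<close>

lemma log_two_sin_le_max:
  assumes "0 < d" "0 < y" "y < 1" "u - d \<le> y" "y \<le> u + d"
  shows "log_two_sin y \<le> log_two_sin_max d u"
proof -
  consider "u + d \<le> 1/2" | "1 - u + d \<le> 1/2" | "u + d > 1/2" "1 - u + d > 1/2"
    by linarith
  then show ?thesis
  proof cases
    case 1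
    then have "min (1/2) (u + d) = u + d" "min (1/2) (1 - u + d) = 1/2" using assms by auto
    moreover have "log_two_sin y \<le> log_two_sin (u + d)"
      using assms 1 by (intro log_two_sin_mono) auto
    ultimately show ?thesis
      by (simp only: log_two_sin_max_def log_two_sin_half add_diff_cancel_right')
  next
    case 2
    then have "min (1/2) (1 - u + d) = 1 - u + d" "min (1/2) (u + d) = 1/2" using assms by auto
    moreover have "log_two_sin (1 - y) \<le> log_two_sin (1 - u + d)"
      using assms 2 by (intro log_two_sin_mono) auto
    ultimately show ?thesis
      by (simp only: log_two_sin_max_def log_two_sin_half log_two_sin_reflect add_diff_cancel_left')
  next
    case 3
    then have "min (1/2) (1 - u + d) = 1/2" "min (1/2) (u + d) = 1/2" by auto
    moreover have "log_two_sin y \<le> ln 2"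
      using assms sin_pi_pos[of y] by (simp add: log_two_sin_def)
    ultimately show ?thesis
      by (simp only: log_two_sin_max_def log_two_sin_half add_diff_cancel_right')
  qed
qed

text \<open>Shifting or reflecting the variable turns the integral of either clamped summand over
  [0,1] into that of \<open>g\<close> over [d, 1+d]. Up to 1/2 this contributes
  \<open>- clausen d\<close>, because \<open>clausen (1/2) = 0\<close>; beyond 1/2 the constant ln 2
  contributes (1/2 + d) ln 2. Doubling and subtracting ln 2 gives the increment of
  \<open>K\<close>.\<close>

lemma log_two_sin_max_antiderivative:
  assumes "0 < d" "d < 1/2"
  obtains K where "\<And>u. u \<in> {0..1} \<Longrightarrow> (K has_real_derivative log_two_sin_max d u) (at u within {0..1})"
    and "K 1 - K 0 = 2 * d * ln 2 - 2 * clausen d"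
proof -
  define g where "g t = log_two_sin (min (1/2) t)" for t
  define P where "P t = integral {d..t} g" for t
  have cont: "continuous_on {d..1 + d} g"
    unfolding g_def using continuous_on_subset[OF continuous_on_log_two_sin_min[OF assms(1)]] by auto
  have P: "(P has_real_derivative g t) (at t within {d..1 + d})" if "t \<in> {d..1 + d}" for t
    unfolding P_def using cont that by (intro integral_has_real_derivative)
  have "(g has_integral clausen (1/2) - clausen d) {d..1/2}"
  proof (rule fundamental_theorem_of_calculus)
    fix t assume t: "t \<in> {d..1/2}"
    then have "g t = log_two_sin t" by (simp add: g_def min_absorb2)
    moreover have "(clausen has_real_derivative log_two_sin t) (at t)"
      using t assms by (intro clausen_has_derivative) auto
    ultimately show "(clausen has_vector_derivative g t) (at t within {d..1/2})"
      by (simp add: has_field_derivative_at_within flip: has_real_derivative_iff_has_vector_derivative)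
  qed (use assms in auto)
  moreover have "((\<lambda>_. ln 2) has_integral (ln 2 * (1/2 + d))) {1/2..1 + d}"
    using has_integral_const_real[of "ln 2 :: real" "1/2" "1 + d"] assms by (simp add: algebra_simps)
  then have "(g has_integral (ln 2 * (1/2 + d))) {1/2..1 + d}"
    by (rule has_integral_eq[rotated]) (simp add: g_def min_absorb1 log_two_sin_half)
  ultimately have "(g has_integral (clausen (1/2) - clausen d + ln 2 * (1/2 + d))) {d..1 + d}"
    using assms by (intro has_integral_combine[of d "1/2"]) auto
  then have P1: "P (1 + d) = ln 2 * (1/2 + d) - clausen d"
    unfolding P_def by (simp add: integral_unique clausen_half)
  have P0: "P d = 0" by (simp add: P_def)
  show thesis
  proof
    fix u :: real assume u: "u \<in> {0..1}"
    have "((\<lambda>u. P (u + d)) has_real_derivative g (u + d) * 1) (at u within {0..1})"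
    proof (rule DERIV_image_chain[of P _ "\<lambda>u. u + d", unfolded o_def])
      show "(P has_real_derivative g (u + d)) (at (u + d) within (\<lambda>u. u + d) ` {0..1})"
        using u assms by (intro DERIV_subset[OF P]) auto
    qed (auto intro!: derivative_eq_intros)
    moreover have "((\<lambda>u. P (1 - u + d)) has_real_derivative g (1 - u + d) * (-1)) (at u within {0..1})"
    proof (rule DERIV_image_chain[of P _ "\<lambda>u. 1 - u + d", unfolded o_def])
      show "(P has_real_derivative g (1 - u + d)) (at (1 - u + d) within (\<lambda>u. 1 - u + d) ` {0..1})"
        using u assms by (intro DERIV_subset[OF P]) auto
    qed (auto intro!: derivative_eq_intros)
    moreover have "((\<lambda>u. u * ln 2) has_real_derivative ln 2) (at u within {0..1})"
      by (auto intro!: derivative_eq_intros)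
    ultimately have "((\<lambda>u. P (u + d) - P (1 - u + d) - u * ln 2) has_real_derivative
        (g (u + d) * 1 - g (1 - u + d) * (-1) - ln 2)) (at u within {0..1})"
      by (intro DERIV_diff)
    then show "((\<lambda>u. P (u + d) - P (1 - u + d) - u * ln 2) has_real_derivative log_two_sin_max d u)
        (at u within {0..1})"
      by (simp add: log_two_sin_max_def g_def)
  qed (simp add: P0 P1 algebra_simps)
qed

text \<open>By the mean value theorem the increment of \<open>K\<close> over a cell of length 1/N is
  \<open>m u / N\<close> for some \<open>u\<close> in that cell, hence at least
  \<open>v i / N\<close>. The increments telescope.\<close>

lemma sum_le_antiderivative:
  fixes K m :: "real \<Rightarrow> real" and v :: "nat \<Rightarrow> real"
  assumes K: "\<And>u. u \<in> {0..1} \<Longrightarrow> (K has_real_derivative m u) (at u within {0..1})"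
    and v: "\<And>i u. i < N \<Longrightarrow> real i / N \<le> u \<Longrightarrow> u \<le> real (Suc i) / N \<Longrightarrow> v i \<le> m u"
    and N: "0 < N"
  shows "(\<Sum>i<N. v i) \<le> N * (K 1 - K 0)"
proof -
  have step: "v i / N \<le> K (real (Suc i) / N) - K (real i / N)" if "i < N" for i
  proof -
    have le: "real i / N < real (Suc i) / N" "real (Suc i) / N \<le> 1"
      using N that by (auto simp: field_simps)
    have "\<exists>u\<in>{real i / N<..<real (Suc i) / N}. K (real (Suc i) / N) - K (real i / N) = (real (Suc i) / N - real i / N) * m u"
    proof -
      have "(K has_derivative (*) (m u)) (at u within {real i / N..real (Suc i) / N})"
        if "real i / N \<le> u" "u \<le> real (Suc i) / N" for u
      proof -
        have "u \<in> {0..1}" "{real i / N..real (Suc i) / N} \<subseteq> {0..1}"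
          using le that by (auto intro: order_trans[of 0 "real i / N"] order_trans[of _ "real (Suc i) / N"])
        with DERIV_subset[OF K] show ?thesis by (simp add: has_field_derivative_def)
      qed
      from mvt_simple[OF le(1) this] show ?thesis by (auto simp: mult.commute)
    qed
    then obtain u where u: "real i / N < u" "u < real (Suc i) / N"
      "K (real (Suc i) / N) - K (real i / N) = (real (Suc i) / N - real i / N) * m u" by auto
    have "real (Suc i) / N - real i / N = 1 / N" using N by (simp add: field_simps)
    with u v[OF that, of u] show ?thesis using N by (simp add: divide_right_mono)
  qed
  have "(\<Sum>i<N. v i) / N \<le> (\<Sum>i<N. K (real (Suc i) / N) - K (real i / N))"
    unfolding sum_divide_distrib by (intro sum_mono step) auto
  also have "\<dots> = K 1 - K 0"
    using N by (subst sum_lessThan_telescope) auto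
  finally show ?thesis using N by (simp add: field_simps)
qed

section \<open>The star-discrepancy: positivity and convergence to 0\<close>

lemma star_discrepancy_ge:
  assumes "a \<in> {0..1}" "0 < N"
  shows "\<bar>real (counting x N a) / real N - a\<bar> \<le> star_discrepancy x N"
  unfolding star_discrepancy_def
proof (rule cSUP_upper[OF assms(1)], rule bdd_aboveI2)
  fix b :: real assume b: "b \<in> {0..1}"
  have "counting x N b \<le> card {1..N}"
    unfolding counting_def by (intro card_mono) auto
  then have "real (counting x N b) / real N \<le> 1"
    using assms by simp
  moreover have "0 \<le> real (counting x N b) / real N"
    by simp
  ultimately show "\<bar>real (counting x N b) / real N - b\<bar> \<le> 1"
    using b unfolding atLeastAtMost_iff by linarith
qed

text \<open>The empirical distribution takes only multiples of 1/N as values, so it misses a =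
  1/(2N).\<close>

lemma star_discrepancy_pos:
  assumes "0 < N"
  shows "0 < star_discrepancy x N"
proof -
  have a: "1 / (2 * real N) \<in> {0..1}" using assms by (simp add: field_simps)
  have "real (counting x N (1 / (2 * N))) / real N \<noteq> 1 / (2 * real N)"
  proof
    assume "real (counting x N (1 / (2 * N))) / real N = 1 / (2 * real N)"
    then have "real (2 * counting x N (1 / (2 * N))) = real 1" using assms by (simp add: field_simps)
    then have "2 * counting x N (1 / (2 * N)) = 1" by (simp only: of_nat_eq_iff)
    then show False by presburger
  qed
  then show ?thesis using star_discrepancy_ge[OF a assms, of x] by auto
qed

text \<open>Pointwise convergence becomes uniform by monotonicity. On the finite grid j/m all errors
  are eventually below 1/m; between neighbouring grid points monotonicity costs at most one further
  spacing 1/m.\<close>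

lemma star_discrepancy_tendsto_0:
  assumes "uniformly_distributed_mod_one x"
  shows "star_discrepancy x \<longlonglongrightarrow> 0"
proof (rule order_tendstoI)
  fix e :: real assume "0 < e"
  then obtain m :: nat where m: "2 / e < real m" "0 < m"
    using reals_Archimedean2[of "2 / e"] \<open>0 < e\<close>
    by (metis divide_pos_pos less_trans of_nat_0_less_iff zero_less_numeral)
  have "\<forall>\<^sub>F N in sequentially. \<bar>real (counting x N (j / m)) / real N - j / m\<bar> < 1 / m"
    if "j \<in> {0..m}" for j
  proof -
    have "j / m \<in> {0..1}" using that m by (auto simp: field_simps)
    then have "(\<lambda>N. real (counting x N (j / m)) / real N) \<longlonglongrightarrow> j / m"
      using assms unfolding uniformly_distributed_mod_one_def by blast
    from tendstoD[OF this, of "1 / m"] m show ?thesis by (simp add: dist_real_def)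
  qed
  then have "\<forall>\<^sub>F N in sequentially.
      \<forall>j\<in>{0..m}. \<bar>real (counting x N (j / m)) / real N - j / m\<bar> < 1 / m"
    by (intro eventually_ball_finite) auto
  then show "\<forall>\<^sub>F N in sequentially. star_discrepancy x N < e"
  proof eventually_elim
    case (elim N)
    define F where "F a = real (counting x N a) / real N" for a
    have mono: "F a \<le> F b" if "a \<le> b" for a b
      unfolding F_def counting_def using that
      by (intro divide_right_mono of_nat_mono card_mono) auto
    have "\<bar>F a - a\<bar> \<le> 2 / m" if a: "a \<in> {0..1}" for a
    proof -
      \<comment> \<open>The grid cell with j/m < a for positive \<open>a\<close>. At a = 0,
        \<open>nat\<close> truncates -1 to 0, so the first cell is used; at a = 1 the last one is,
        and \<open>Suc j\<close> never exceeds \<open>m\<close>.\<close>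
      define j where "j = nat (ceiling (a * m) - 1)"
      have "0 \<le> a * m" "a * m \<le> m" using a m by (auto simp: mult_left_le_one_le)
      then have "real j \<le> a * m" "a * m \<le> real (Suc j)" "Suc j \<le> m"
        unfolding j_def using m by linarith+
      then have le: "j / m \<le> a" "a \<le> Suc j / m" using m by (auto simp: field_simps)
      have "\<bar>F (j / m) - j / m\<bar> < 1 / m" "\<bar>F (Suc j / m) - Suc j / m\<bar> < 1 / m"
        using elim[THEN bspec, of j] elim[THEN bspec, of "Suc j"] \<open>Suc j \<le> m\<close> by (auto simp: F_def)
      moreover have "Suc j / m = j / m + 1 / m" by (simp add: add_divide_distrib)
      ultimately show ?thesis
        using mono[OF le(1)] mono[OF le(2)] le by linarith
    qed
    then have "star_discrepancy x N \<le> 2 / m"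
      unfolding star_discrepancy_def F_def by (intro cSUP_least) auto
    also have "\<dots> < e" using m \<open>0 < e\<close> by (simp add: field_simps)
    finally show ?case .
  qed
next
  fix e :: real assume "e < 0"
  show "\<forall>\<^sub>F N in sequentially. e < star_discrepancy x N"
    using eventually_gt_at_top[of 0]
    by eventually_elim (use \<open>e < 0\<close> star_discrepancy_pos[of _ x] in \<open>auto intro: less_trans\<close>)
qed

section \<open>Position of the sorted points\<close>

lemma length_filter_less_sorted:
  fixes ys :: "real list"
  assumes "sorted ys" "i < length ys"
  shows "ys ! i < a \<longleftrightarrow> i < length (filter (\<lambda>y. y < a) ys)"
proof -
  \<comment> \<open>Sortedness makes this set an initial segment of the indices, so membership of
    \<open>i\<close> is decided by its size.\<close>
  let ?J = "{j. j < length ys \<and> ys ! j < a}"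
  have len: "length (filter (\<lambda>y. y < a) ys) = card ?J"
    by (rule length_filter_conv_card)
  show ?thesis
  proof
    assume "ys ! i < a"
    then have "{..i} \<subseteq> ?J"
      using assms by (auto intro: le_less_trans[OF sorted_nth_mono])
    then have "card {..i} \<le> card ?J"
      by (intro card_mono) auto
    then show "i < length (filter (\<lambda>y. y < a) ys)"
      by (simp add: len)
  next
    assume *: "i < length (filter (\<lambda>y. y < a) ys)"
    show "ys ! i < a"
    proof (rule ccontr)
      assume "\<not> ys ! i < a"
      then have "j < i" if "j \<in> ?J" for j
        using that assms sorted_nth_mono[of ys i j] by (cases "i \<le> j") auto
      then have "?J \<subseteq> {..<i}"
        by auto
      then have "card ?J \<le> card {..<i}"
        by (intro card_mono) auto
      with * show False by (simp add: len)
    qed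
  qed
qed

text \<open>Since indices start at 0, \<open>ys ! i\<close> lies below \<open>a\<close> exactly when
  at least i+1 points do. Every \<open>a\<close> above i/N + D has more than i points below it;
  every \<open>a\<close> in (0,1) above \<open>ys ! i\<close> has at least i+1, which forces a >=
  (i+1)/N - D. Letting \<open>a\<close> tend to the respective bound gives both claims.\<close>

lemma sorted_points_bounds:
  assumes "\<And>k. k \<in> {1..N} \<Longrightarrow> x k \<in> {0..1}" "i < N"
  defines "ys \<equiv> sort (map x [1..<Suc N])"
  shows "real (Suc i) / N - star_discrepancy x N \<le> ys ! i"
    and "ys ! i \<le> real i / N + star_discrepancy x N"
proof -
  let ?D = "star_discrepancy x N"
  have [simp]: "length ys = N" by (simp add: ys_def)
  have "0 < N" using assms by simp
  have cnt: "counting x N a = length (filter (\<lambda>y. y < a) ys)" for a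
  proof -
    have "length (filter (\<lambda>y. y < a) ys) = size (filter_mset (\<lambda>y. y < a) (mset ys))"
      by (metis mset_filter size_mset)
    also have "mset ys = mset (map x [1..<Suc N])"
      by (simp add: ys_def)
    also have "size (filter_mset (\<lambda>y. y < a) \<dots>) = length (filter (\<lambda>k. x k < a) [1..<Suc N])"
      by (simp only: mset_filter[symmetric] size_mset filter_map length_map comp_def)
    also have "\<dots> = card {k \<in> {1..<Suc N}. x k < a}"
      by (subst distinct_length_filter) (auto intro!: arg_cong[of _ _ card])
    also have "{k \<in> {1..<Suc N}. x k < a} = {n \<in> {1..N}. x n \<in> {0..<a}}"
      using assms(1) by auto
    finally show ?thesis by (simp add: counting_def)
  qed
  have iff: "ys ! i < a \<longleftrightarrow> i < counting x N a" for a
    unfolding cnt using assms by (intro length_filter_less_sorted) (auto simp: ys_def)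
  have range: "ys ! i \<in> {0..1}"
    using assms nth_mem[of i ys] by (auto simp: ys_def simp del: upt_Suc nth_mem)
  show "ys ! i \<le> real i / N + ?D"
  proof (rule dense_ge)
    fix a assume "real i / N + ?D < a"
    show "ys ! i \<le> a"
    \<comment> \<open>The discrepancy controls only \<open>a\<close> in [0,1]; a larger
      \<open>a\<close> exceeds every point anyway.\<close>
    proof (cases "a \<le> 1")
      case True
      have "0 \<le> real i / N" by simp
      then have a: "a \<in> {0..1}"
        using True star_discrepancy_pos[OF \<open>0 < N\<close>, of x] \<open>real i / N + ?D < a\<close>
        unfolding atLeastAtMost_iff by linarith
      have "real i / N < real (counting x N a) / N"
        using star_discrepancy_ge[OF a \<open>0 < N\<close>, of x] \<open>real i / N + ?D < a\<close> by linarith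
      then show ?thesis using iff[of a] \<open>0 < N\<close> by (simp add: divide_less_cancel)
    qed (use range in auto)
  qed
  show "real (Suc i) / N - ?D \<le> ys ! i"
  \<comment> \<open>If the point is 1, no admissible \<open>a\<close> lies above it, but then the
    bound follows from (i+1)/N <= 1.\<close>
  proof (cases "ys ! i = 1")
    case True
    then show ?thesis
      using assms star_discrepancy_pos[OF \<open>0 < N\<close>, of x] by (auto intro!: diff_le_eq[THEN iffD2] add_increasing2 simp: field_simps)
  next
    case False
    show ?thesis
    proof (rule dense_ge_bounded)
      show "ys ! i < 1" using False range by auto
      fix a assume a: "ys ! i < a" "a < 1"
      then have "real (Suc i) / N \<le> real (counting x N a) / N"
        using iff[of a] by (intro divide_right_mono) auto
      moreover have "a \<in> {0..1}" using a range by auto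
      ultimately show "real (Suc i) / N - ?D \<le> a"
        using star_discrepancy_ge[of a N x] \<open>0 < N\<close> by fastforce
    qed
  qed
qed

section \<open>The bound for the sum of logarithms and the conclusion\<close>

lemma sum_log_two_sin_le:
  assumes x: "\<And>k. k \<in> {1..N} \<Longrightarrow> x k \<in> {0<..<1}" and N: "0 < N"
    and d: "star_discrepancy x N < 1/2"
  shows "(\<Sum>k=1..N. log_two_sin (x k)) \<le>
    N * (2 * star_discrepancy x N * ln 2 - 2 * clausen (star_discrepancy x N))"
proof -
  let ?D = "star_discrepancy x N"
  define ys where "ys = sort (map x [1..<Suc N])"
  have len: "length ys = N" by (simp add: ys_def)
  have D: "0 < ?D" using star_discrepancy_pos[OF N] .
  obtain K where K: "\<And>u. u \<in> {0..1} \<Longrightarrow>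
      (K has_real_derivative log_two_sin_max ?D u) (at u within {0..1})"
    "K 1 - K 0 = 2 * ?D * ln 2 - 2 * clausen ?D"
    using log_two_sin_max_antiderivative[OF D d] by blast
  have "(\<Sum>k=1..N. log_two_sin (x k)) = sum_list (map (\<lambda>k. log_two_sin (x k)) [1..<Suc N])"
    by (subst sum.distinct_set_conv_list[symmetric]) (auto intro!: sum.cong)
  also have "\<dots> = sum_mset (mset (map log_two_sin (map x [1..<Suc N])))"
    by (simp only: sum_mset_sum_list map_map comp_def)
  also have "mset (map log_two_sin (map x [1..<Suc N])) = mset (map log_two_sin ys)"
    by (simp only: ys_def mset_map mset_sort)
  also have "sum_mset \<dots> = (\<Sum>i<N. log_two_sin (ys ! i))"
    by (simp only: sum_mset_sum_list) (simp add: sum_list_sum_nth len atLeast0LessThan)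
  also have "\<dots> \<le> N * (K 1 - K 0)"
  proof (rule sum_le_antiderivative[OF K(1) _ N])
    fix i u assume i: "i < N" and u: "real i / N \<le> u" "u \<le> real (Suc i) / N"
    have "ys ! i \<in> set ys" using i len by simp
    then have "ys ! i \<in> {0<..<1}"
      using x by (auto simp: ys_def simp del: upt_Suc)
    moreover have "real (Suc i) / N - ?D \<le> ys ! i" "ys ! i \<le> real i / N + ?D"
      unfolding ys_def using x i by (intro sorted_points_bounds; force)+
    \<comment> \<open>For every \<open>u\<close> in the cell, u - D <= (i+1)/N - D and i/N + D <= u
      + D, so the window around \<open>u\<close> contains \<open>ys ! i\<close>.\<close>
    ultimately show "log_two_sin (ys ! i) \<le> log_two_sin_max ?D u"
      using u D unfolding greaterThanLessThan_iff by (intro log_two_sin_le_max) linarith+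
  qed
  finally show ?thesis unfolding K(2) .
qed

theorem theorem1:
  fixes x :: "nat \<Rightarrow> real" and \<Delta> :: "nat \<Rightarrow> real"
  assumes "\<And>k. k \<ge> 1 \<Longrightarrow> x k \<in> {0..1}"
    and "uniformly_distributed_mod_one x"
  defines "\<Delta> \<equiv> \<lambda>N. real N * star_discrepancy x N"
  shows "\<forall>\<^sub>F N in sequentially.
           (\<Prod>k=1..N. 2 * sin (pi * x k)) \<le> (real N / \<Delta> N) powr (2 * \<Delta> N)"
proof -
  let ?D = "star_discrepancy x"
  \<comment> \<open>The slack ln pi - 1 is positive because e < 3 < pi; it serves as the error
    constant in \<open>clausen_lower\<close>.\<close>
  have "exp 1 < (pi::real)"
    using e_less_272 pi_gt3 by simp
  then have "0 < ln pi - 1"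
    by (metis diff_gt_0_iff_gt exp_less_cancel_iff exp_ln pi_gt_zero)
  from clausen_lower[OF this]
  have lower: "\<forall>\<^sub>F t in at_right 0. t * ln (2 * pi * t) - t - (ln pi - 1) * t \<le> clausen t" .
  have lim: "filterlim ?D (at_right 0) sequentially"
    unfolding filterlim_at
  proof
    show "\<forall>\<^sub>F N in sequentially. ?D N \<in> {0<..} \<and> ?D N \<noteq> 0"
      using eventually_gt_at_top[of "0::nat"]
    proof eventually_elim
      case (elim N)
      then show ?case using star_discrepancy_pos[of N x] by simp
    qed
  qed (rule star_discrepancy_tendsto_0[OF assms(2)])
  have "\<forall>\<^sub>F N in sequentially. ?D N < 1/2"
    by (rule order_tendstoD(2)[OF star_discrepancy_tendsto_0[OF assms(2)]]) simp
  moreover note eventually_gt_at_top[of "0::nat"] eventually_compose_filterlim[OF lower lim]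
  ultimately show ?thesis
  proof eventually_elim
    case (elim N)
    let ?d = "?D N"
    have d: "0 < ?d" using star_discrepancy_pos elim by blast
    show ?case
    \<comment> \<open>A point at 0 or 1 has no usable logarithm, but it makes the product vanish,
      and the right-hand side is nonnegative.\<close>
    proof (cases "\<exists>k\<in>{1..N}. x k \<notin> {0<..<1}")
      case True
      then obtain k where k: "k \<in> {1..N}" "x k = 0 \<or> x k = 1"
        using assms(1) by force
      then have "2 * sin (pi * x k) = 0" by auto
      then have "(\<Prod>k=1..N. 2 * sin (pi * x k)) = 0"
        using k by (intro prod_zero) auto
      then show ?thesis by (simp only: powr_ge_zero)
    next
      case False
      then have x: "x k \<in> {0<..<1}" if "k \<in> {1..N}" for k using that by blast
      have "(\<Prod>k=1..N. 2 * sin (pi * x k)) = (\<Prod>k=1..N. exp (log_two_sin (x k)))"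
        using x sin_pi_pos by (intro prod.cong) (auto simp: log_two_sin_def)
      also have "\<dots> = exp (\<Sum>k=1..N. log_two_sin (x k))"
        by (simp add: exp_sum)
      also have "\<dots> \<le> exp (N * (2 * ?d * ln 2 - 2 * clausen ?d))"
        using sum_log_two_sin_le[of N x] x elim by simp
      also have "\<dots> \<le> exp (N * (2 * ?d * - ln ?d))"
      proof -
        \<comment> \<open>With this choice of error constant, the terms d ln pi, - d and - (ln pi -
          1) d cancel exactly and leave d ln 2 + d ln d. The ln 2 then cancels against 2 d ln 2 in
          the bound.\<close>
        have "ln (2 * pi * ?d) = ln 2 + ln pi + ln ?d"
          using d by (simp add: ln_mult)
        then have "?d * ln 2 + ?d * ln ?d \<le> clausen ?d"
          using elim(3) by (simp add: algebra_simps)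
        then have "2 * ?d * ln 2 - 2 * clausen ?d \<le> 2 * ?d * - ln ?d"
          by (simp add: algebra_simps)
        then show ?thesis
          unfolding exp_le_cancel_iff by (rule mult_left_mono) simp
      qed
      \<comment> \<open>The base N / (N d) is 1/d, whose logarithm is - ln d.\<close>
      also have "\<dots> = (real N / \<Delta> N) powr (2 * \<Delta> N)"
        using d elim by (simp add: \<Delta>_def powr_def ln_div ln_inverse algebra_simps)
      finally show ?thesis .
    qed
  qed
qed

end
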